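(* Let $0\le k\le n$, let $X$ be a compact $\ell_1$-convex subset of $\mathbb{R}^n$, and let $I$ be a compact interval in $\mathbb{R}^n$. Then \[ \int_{\mathrm{Isom}(\ell_1^n)} V_k(gX\cap I)\,dg=\sum_{i+j=n+k}\binom{n}{i}^{-1}\binom{j}{k}V_i(X)V_j(I), \] where $0\le i\le n$ and $0\le j\le n$ in the summation.
   Context: $\ell_1^n$ is $\mathbb{R}^n$ with metric $d(x,y)=\sum_i|x_i-y_i|$. $X$ is $\ell_1$-convex if any two points $x,x'\in X$ are joined by a distance-preserving map $\gamma\colon[0,d(x,x')]\to X$ with $\gamma(0)=x$, $\gamma(d(x,x'))=x'$. An interval in $\mathbb{R}^n$ is a product $I_1\times\cdots\times I_n$ of (possibly empty) intervals in $\mathbb{R}$; the intersection of an $\ell_1$-convex set with an interval is $\ell_1$-convex. $\mathrm{Isom}(\ell_1^n)$ is the isometry group; every isometry is uniquely $x\mapsto h(x)+q$ with $h$ in the finite group $H_n$ of isometries fixing $0$ (generated by coordinate permutations and sign changes) and $q\in\mathbb{R}^n$; the measure on $\mathrm{Isom}(\ell_1^n)$ is the product of the uniform probability measure on $H_n$ and Lebesgue measure on $\mathbb{R}^n$. $V_i(Y)=\sum_{P\in G_{n,i}}\mathrm{Vol}_i(\pi_PY)$, where $G_{n,i}$ is the set of $i$-dimensional coordinate subspaces (spanned by $i$ standard basis vectors), $\pi_P$ orthogonal projection and $\mathrm{Vol}_i$ Lebesgue measure on $P$. *)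

theory Defs
  imports "HOL-Analysis.Analysis"
begin

definition l1dist :: "real^'n \<Rightarrow> real^'n \<Rightarrow> real" where
  "l1dist x y = (\<Sum>i\<in>UNIV. \<bar>x$i - y$i\<bar>)"

definition l1_convex :: "(real^'n) set \<Rightarrow> bool" where
  "l1_convex X \<longleftrightarrow> (\<forall>x\<in>X. \<forall>x'\<in>X. \<exists>\<gamma> :: real \<Rightarrow> real^'n.
      \<gamma> ` {0..l1dist x x'} \<subseteq> X \<and> \<gamma> 0 = x \<and> \<gamma> (l1dist x x') = x' \<and>
      (\<forall>s\<in>{0..l1dist x x'}. \<forall>t\<in>{0..l1dist x x'}. l1dist (\<gamma> s) (\<gamma> t) = \<bar>s - t\<bar>))"

text \<open>The finite group H_n of isometries fixing 0: coordinate permutations and sign changes.\<close>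
definition Hn :: "(real^'n \<Rightarrow> real^'n) set" where
  "Hn = {h. \<exists>\<sigma> s. \<sigma> permutes (UNIV :: 'n set) \<and> (\<forall>i. s i = 1 \<or> s i = -1) \<and>
              h = (\<lambda>x. \<chi> i. s i * x $ (\<sigma> i))}"

text \<open>Integral over Isom(l1^n) w.r.t. (uniform probability on H_n) x (Lebesgue measure on R^n),
  of a function of the isometry g = (x \<mapsto> h x + q).\<close>
definition isom_integral :: "((real^'n \<Rightarrow> real^'n) \<Rightarrow> real) \<Rightarrow> real" where
  "isom_integral F = (\<Sum>h\<in>Hn. (LINT q|lborel. F (\<lambda>x. h x + q))) / real (card (Hn :: (real^'n \<Rightarrow> real^'n) set))"

definition proj_vol :: "'n set \<Rightarrow> (real^'n) set \<Rightarrow> real" where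
  "proj_vol S Y = measure (Pi\<^sub>M S (\<lambda>_. lborel)) ((\<lambda>x. restrict (\<lambda>i. x $ i) S) ` Y)"

definition V :: "nat \<Rightarrow> (real^'n) set \<Rightarrow> real" where
  "V i Y = (\<Sum>S\<in>{S :: 'n set. card S = i}. proj_vol S Y)"

end

theory Submission
  imports Defs
begin

text \<open>
  Fix a coordinate set \<open>S\<close> of size \<open>k\<close>. Substituting \<open>y i - w i\<close> for the translation \<open>q i\<close>
  (\<open>i \<in> S\<close>) and applying Fubini, the integral over \<open>q\<close> of the volume of the \<open>S\<close>-projection of
  \<open>(X + q) \<inter> I\<close> becomes \<open>Vol (\<pi>\<^sub>S I)\<close> times the volume of the set of all \<open>w\<close> for which some
  \<open>x \<in> X\<close> satisfies \<open>x i = w i\<close> for \<open>i \<in> S\<close> and \<open>x i + w i \<in> I i\<close> for \<open>i \<notin> S\<close>. A geodesic moves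
  monotonically in each coordinate, so every box section of \<open>X\<close> projects to an interval on each
  axis. Hence relaxing one more equation \<open>x i = w i\<close> to \<open>x i + w i \<in> I i\<close> lengthens each nonempty
  fibre by exactly the length of \<open>I i\<close>, and by induction the volume is a sum, over all
  \<open>T \<subseteq> - S\<close>, of \<open>Vol (\<pi>\<^bsub>S \<union> T\<^esub> X)\<close> times the volume of the remaining sides of \<open>I\<close>. Averaging over
  \<open>H\<^sub>n\<close> replaces the volume of the projection of \<open>X\<close> by \<open>V\<^sub>i(X)\<close> divided by the number of
  coordinate sets of size \<open>i = card (S \<union> T)\<close>.
\<close>

text \<open>Coordinates of a geodesic are 1-Lipschitz, so the intermediate value theorem yields a
  point with the prescribed coordinate. The two bounds place it in the box spanned by the endpoints;
  hence it satisfies every coordinatewise interval condition that both endpoints satisfy.\<close>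

lemma l1_convex_intermediate:
  fixes X :: "(real^'n) set"
  assumes X: "l1_convex X" "x \<in> X" "x' \<in> X" and t: "x $ i \<le> t" "t \<le> x' $ i"
  obtains z where "z \<in> X" "z $ i = t"
    "\<And>j. min (x $ j) (x' $ j) \<le> z $ j" "\<And>j. z $ j \<le> max (x $ j) (x' $ j)"
proof -
  define D where "D = l1dist x x'"
  obtain \<gamma> where \<gamma>: "\<gamma> ` {0..D} \<subseteq> X" "\<gamma> 0 = x" "\<gamma> D = x'"
    "\<And>s t. s \<in> {0..D} \<Longrightarrow> t \<in> {0..D} \<Longrightarrow> l1dist (\<gamma> s) (\<gamma> t) = \<bar>s - t\<bar>"
    using X unfolding l1_convex_def D_def by (metis (no_types, lifting))
  have D0: "0 \<le> D" by (simp add: D_def l1dist_def sum_nonneg)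
  have lip: "\<bar>y $ i - z $ i\<bar> \<le> l1dist y z" for y z :: "real^'n"
    unfolding l1dist_def by (rule member_le_sum) auto
  have "1-lipschitz_on {0..D} (\<lambda>s. \<gamma> s $ i)"
    by (rule lipschitz_onI) (use \<gamma>(4) lip in \<open>metis dist_real_def mult_1\<close>, simp)
  then have "continuous_on {0..D} (\<lambda>s. \<gamma> s $ i)"
    by (rule lipschitz_on_continuous_on)
  then obtain s where s: "0 \<le> s" "s \<le> D" "\<gamma> s $ i = t"
    using IVT'[of "\<lambda>s. \<gamma> s $ i" 0 t D] t \<gamma> D0 by auto
  define z where "z = \<gamma> s"
  have "l1dist x z = s" "l1dist z x' = D - s"
    using \<gamma>(4)[of 0 s] \<gamma>(4)[of s D] s D0 \<gamma>(2,3) by (auto simp: z_def)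
  \<comment> \<open>Lengths add along a geodesic. Each summand is nonnegative by the triangle
    inequality in its own coordinate, so a zero total forces equality coordinate by
    coordinate.\<close>
  then have "(\<Sum>j\<in>UNIV. \<bar>x $ j - z $ j\<bar> + \<bar>z $ j - x' $ j\<bar> - \<bar>x $ j - x' $ j\<bar>) = 0"
    unfolding l1dist_def D_def by (simp add: sum.distrib sum_subtractf)
  then have "\<bar>x $ j - z $ j\<bar> + \<bar>z $ j - x' $ j\<bar> - \<bar>x $ j - x' $ j\<bar> = 0" for j
    by (subst (asm) sum_nonneg_eq_0_iff) auto
  then have *: "\<bar>x $ j - z $ j\<bar> + \<bar>z $ j - x' $ j\<bar> = \<bar>x $ j - x' $ j\<bar>" for j
    by (simp add: algebra_simps)
  show thesis
  proof (rule that)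
    show "z \<in> X" using \<gamma>(1) s by (auto simp: z_def)
    show "z $ i = t" using s by (simp add: z_def)
    show "min (x $ j) (x' $ j) \<le> z $ j" for j using *[of j] by linarith
    show "z $ j \<le> max (x $ j) (x' $ j)" for j using *[of j] by linarith
  qed
qed

section \<open>Mixed sets: some coordinates prescribed, others only confined to a side of the
  box\<close>

text \<open>Coordinates outside \<open>S \<union> B\<close> are projected away.\<close>

definition mixed_set :: "(real^'n) set \<Rightarrow> real^'n \<Rightarrow> real^'n \<Rightarrow> 'n set \<Rightarrow> 'n set \<Rightarrow> ('n \<Rightarrow> real) set" where
  "mixed_set X a b S B = {w \<in> S \<union> B \<rightarrow>\<^sub>E UNIV. \<exists>x\<in>X. (\<forall>i\<in>S. x $ i = w i) \<and>
      (\<forall>i\<in>B. a $ i \<le> x $ i + w i \<and> x $ i + w i \<le> b $ i)}"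

abbreviation leb :: "'n set \<Rightarrow> ('n \<Rightarrow> real) measure" where
  "leb S \<equiv> Pi\<^sub>M S (\<lambda>_. lborel)"

abbreviation proj :: "'n set \<Rightarrow> real^'n \<Rightarrow> 'n \<Rightarrow> real" where
  "proj S x \<equiv> restrict (\<lambda>i. x $ i) S"

interpretation leb: product_sigma_finite "\<lambda>_::'n. lborel :: real measure"
  by standard

text \<open>Points of \<open>leb A\<close> are functions on \<open>A\<close>, whereas closed sets
  are available for vectors. Pulling back along this map transfers Borel sets; the filler 0 never
  enters the conditions under study, which mention coordinates in \<open>A\<close> only.\<close>

lemma measurable_extend_vec [measurable]:
  "(\<lambda>w. \<chi> i. if i \<in> A then w i else 0) \<in> borel_measurable (leb (A::'n::finite set))"
proof -
  have "(\<lambda>w. (if i \<in> A then w i else 0) :: real) \<in> borel_measurable (leb A)" for i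
    using measurable_component_singleton[of i A "\<lambda>_. lborel"] by (cases "i \<in> A") auto
  then show ?thesis
    by (subst borel_measurable_euclidean_space) (auto simp: Basis_vec_def inner_axis)
qed

lemma closed_Collect_ball:
  assumes "\<And>i. i \<in> S \<Longrightarrow> closed {x. P i x}"
  shows "closed {x. \<forall>i\<in>S. P i x}"
  unfolding Collect_ball_eq using assms by (intro closed_INT) auto

text \<open>Quantifying existentially over a compact set keeps a closed relation closed, while the
  projection of a general Borel set need not be Borel. Compactness of \<open>X\<close> enters here
  as the source of measurability.\<close>

lemma sets_projection:
  fixes X :: "(real^'n) set"
  assumes "compact X" "closed T"
  shows "{w \<in> space (leb A). \<exists>x\<in>X. (x, \<chi> i. if i \<in> A then w i else 0) \<in> T} \<in> sets (leb A)"
proof -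
  have [measurable]: "{y. \<exists>x. x \<in> X \<and> (x, y) \<in> T} \<in> sets borel"
    using closed_compact_projection[OF assms] by simp
  have "(\<lambda>w. \<chi> i. if i \<in> A then w i else 0) -` {y. \<exists>x. x \<in> X \<and> (x, y) \<in> T} \<inter> space (leb A) \<in> sets (leb A)"
    by measurable
  then show ?thesis
    by (rule back_subst[where P="\<lambda>S. S \<in> _"]) auto
qed

lemma sets_mixed_set:
  fixes X :: "(real^'n) set"
  assumes X: "compact X"
  shows "mixed_set X a b S B \<in> sets (leb (S \<union> B))"
proof -
  let ?T = "{p. (\<forall>i\<in>S. fst p $ i = snd p $ i) \<and>
    (\<forall>i\<in>B. a $ i \<le> fst p $ i + snd p $ i \<and> fst p $ i + snd p $ i \<le> b $ i)}"
  have "closed ?T"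
    by (intro closed_Collect_conj closed_Collect_ball closed_Collect_eq closed_Collect_le
        continuous_intros)
  from sets_projection[OF X this, of "S \<union> B"] show ?thesis
    by (rule back_subst[where P="\<lambda>S. S \<in> _"])
       (auto simp: mixed_set_def space_PiM)
qed

text \<open>Slice all sets along coordinate \<open>i\<close>. With the other coordinates of
  \<open>w\<close> fixed, the admissible points of \<open>X\<close> have \<open>i\<close>-th
  coordinates filling a compact interval \<open>{l..u}\<close>. If it is nonempty, the equation
  \<open>x $ i = y\<close> leaves a fibre of length \<open>u - l\<close>, and the relaxed condition
  gives \<open>{a $ i - u..b $ i - l}\<close>, longer by exactly
  \<open>b $ i - a $ i\<close>.\<close>

lemma emeasure_mixed_set_insert:
  fixes X :: "(real^'n) set"
  assumes X: "compact X" "l1_convex X" and i: "i \<notin> S" "i \<notin> B" and ab: "a $ i \<le> b $ i"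
  shows "emeasure (leb (S \<union> insert i B)) (mixed_set X a b S (insert i B)) =
    emeasure (leb (insert i S \<union> B)) (mixed_set X a b (insert i S) B) +
    ennreal (b $ i - a $ i) * emeasure (leb (S \<union> B)) (mixed_set X a b S B)"
proof -
  note [measurable] = sets_mixed_set[OF X(1)]
  let ?A = "S \<union> B" and ?W = "mixed_set X a b"
  have eq: "S \<union> insert i B = insert i ?A" "insert i S \<union> B = insert i ?A"
    by auto
  have m1[measurable]: "?W S (insert i B) \<in> sets (leb (insert i ?A))" and
    m2[measurable]: "?W (insert i S) B \<in> sets (leb (insert i ?A))"
    using sets_mixed_set[OF X(1), of a b S "insert i B"]
      sets_mixed_set[OF X(1), of a b "insert i S" B] unfolding eq by simp_all
  have ins: "emeasure (leb (insert i ?A)) W = (\<integral>\<^sup>+w. emeasure lborel {y. w(i := y) \<in> W} \<partial>leb ?A)"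
    if [measurable]: "W \<in> sets (leb (insert i ?A))" for W :: "('n \<Rightarrow> real) set"
  proof -
    have "emeasure (leb (insert i ?A)) W = (\<integral>\<^sup>+w. indicator W w \<partial>leb (insert i ?A))"
      by simp
    also have "\<dots> = (\<integral>\<^sup>+w. \<integral>\<^sup>+y. indicator W (w(i := y)) \<partial>lborel \<partial>leb ?A)"
      using i by (intro leb.product_nn_integral_insert) auto
    also have "\<dots> = (\<integral>\<^sup>+w. emeasure lborel {y. w(i := y) \<in> W} \<partial>leb ?A)"
    proof (rule nn_integral_cong)
      fix w assume w: "w \<in> space (leb ?A)"
      have "(\<lambda>y. w(i := y)) \<in> measurable lborel (leb (insert i ?A))"
        using w i by (intro measurable_fun_upd[where J = ?A]) auto
      then have "(\<lambda>y. w(i := y)) -` W \<inter> space lborel \<in> sets lborel"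
        by measurable
      then have "{y. w(i := y) \<in> W} \<in> sets lborel"
        by (simp add: vimage_def)
      moreover have ind: "(\<lambda>y. indicator W (w(i := y)) :: ennreal) = indicator {y. w(i := y) \<in> W}"
        by (auto simp: indicator_def fun_eq_iff)
      ultimately show "(\<integral>\<^sup>+y. indicator W (w(i := y)) \<partial>lborel) = emeasure lborel {y. w(i := y) \<in> W}"
        unfolding ind by simp
    qed
    finally show ?thesis .
  qed
  have fibre: "emeasure lborel {y. w(i := y) \<in> ?W S (insert i B)} =
      emeasure lborel {y. w(i := y) \<in> ?W (insert i S) B} +
      ennreal (b $ i - a $ i) * indicator (?W S B) w"
    if w: "w \<in> space (leb ?A)" for w
  proof -
    define C where "C = {x \<in> X. (\<forall>j\<in>S. x $ j = w j) \<and> (\<forall>j\<in>B. a $ j \<le> x $ j + w j \<and> x $ j + w j \<le> b $ j)}"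
    define F where "F = (\<lambda>x. x $ i) ` C"
    have "C = X \<inter> {x. (\<forall>j\<in>S. x $ j = w j) \<and> (\<forall>j\<in>B. a $ j \<le> x $ j + w j \<and> x $ j + w j \<le> b $ j)}"
      by (auto simp: C_def)
    also have "compact \<dots>"
      by (intro compact_Int_closed X closed_Collect_conj closed_Collect_ball closed_Collect_eq
          closed_Collect_le continuous_intros)
    finally have "compact F"
      unfolding F_def by (intro compact_continuous_image continuous_intros)
    \<comment> \<open>This is where convexity is used: a point between two points of
      \<open>C\<close> inherits the equations over \<open>S\<close>, because both endpoints have the
      same coordinate there, and the interval conditions over \<open>B\<close>.\<close>
    moreover have "connected F"
    proof (rule connectedI_interval)
      fix s t u assume "s \<in> F" "u \<in> F" "s \<le> t" "t \<le> u"
      then obtain x x' where x: "x \<in> C" "x' \<in> C" "x $ i \<le> t" "t \<le> x' $ i"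
        by (auto simp: F_def)
      then obtain z where z: "z \<in> X" "z $ i = t"
          "\<And>j. min (x $ j) (x' $ j) \<le> z $ j" "\<And>j. z $ j \<le> max (x $ j) (x' $ j)"
        using l1_convex_intermediate[OF X(2), of x x' i t] by (auto simp: C_def)
      have "z \<in> C"
        unfolding C_def
      proof (intro CollectI conjI ballI)
        fix j assume "j \<in> S"
        then have "x $ j = w j" "x' $ j = w j"
          using x by (auto simp: C_def)
        then show "z $ j = w j"
          using z(3,4)[of j] by simp
      next
        fix j assume "j \<in> B"
        then have "a $ j \<le> x $ j + w j" "x $ j + w j \<le> b $ j" "a $ j \<le> x' $ j + w j" "x' $ j + w j \<le> b $ j"
          using x by (auto simp: C_def)
        then show "a $ j \<le> z $ j + w j" "z $ j + w j \<le> b $ j"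
          using z(3,4)[of j] by linarith+
      qed fact
      then show "t \<in> F"
        using z by (auto simp: F_def)
    qed
    ultimately obtain l u where F: "F = {l..u}"
      using connected_compact_interval_1 by blast
    have ext: "w(i := y) \<in> insert i ?A \<rightarrow>\<^sub>E UNIV" "w \<in> ?A \<rightarrow>\<^sub>E UNIV" for y
      using w by (auto simp: space_PiM PiE_def extensional_def)
    have updS: "(\<forall>j\<in>S. x $ j = (w(i := y)) j) \<longleftrightarrow> (\<forall>j\<in>S. x $ j = w j)" for x y
      using i by (intro ball_cong) auto
    have updB: "(\<forall>j\<in>B. a $ j \<le> x $ j + (w(i := y)) j \<and> x $ j + (w(i := y)) j \<le> b $ j) \<longleftrightarrow>
        (\<forall>j\<in>B. a $ j \<le> x $ j + w j \<and> x $ j + w j \<le> b $ j)" for x y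
      using i by (intro ball_cong) auto
    have "w(i := y) \<in> ?W S (insert i B) \<longleftrightarrow>
        (\<exists>x\<in>C. a $ i \<le> x $ i + y \<and> x $ i + y \<le> b $ i)" for y
    proof -
      have "w(i := y) \<in> ?W S (insert i B) \<longleftrightarrow> (\<exists>x\<in>X. (\<forall>j\<in>S. x $ j = (w(i := y)) j) \<and>
          (\<forall>j\<in>insert i B. a $ j \<le> x $ j + (w(i := y)) j \<and> x $ j + (w(i := y)) j \<le> b $ j))"
        using ext(1)[of y] unfolding mixed_set_def mem_Collect_eq eq by blast
      then show ?thesis
        unfolding ball_simps(7) updS updB C_def fun_upd_same by blast
    qed
    then have 1: "{y. w(i := y) \<in> ?W S (insert i B)} = {y. \<exists>t\<in>F. a $ i \<le> t + y \<and> t + y \<le> b $ i}"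
      by (simp add: F_def)
    have "w(i := y) \<in> ?W (insert i S) B \<longleftrightarrow> (\<exists>x\<in>C. x $ i = y)" for y
    proof -
      have "w(i := y) \<in> ?W (insert i S) B \<longleftrightarrow> (\<exists>x\<in>X. (\<forall>j\<in>insert i S. x $ j = (w(i := y)) j) \<and>
          (\<forall>j\<in>B. a $ j \<le> x $ j + (w(i := y)) j \<and> x $ j + (w(i := y)) j \<le> b $ j))"
        using ext(1)[of y] unfolding mixed_set_def mem_Collect_eq eq by blast
      then show ?thesis
        unfolding ball_simps(7) updS updB C_def fun_upd_same by blast
    qed
    then have 2: "{y. w(i := y) \<in> ?W (insert i S) B} = F"
      by (auto simp: F_def)
    have 3: "w \<in> ?W S B \<longleftrightarrow> F \<noteq> {}"
      using ext unfolding mixed_set_def F_def C_def by auto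
    show ?thesis
    proof (cases "l \<le> u")
      case True
      \<comment> \<open>The witness is the smallest element of \<open>F\<close> meeting the lower
        bound. It meets the upper bound because \<open>y \<le> b $ i - l\<close> and
        \<open>a $ i \<le> b $ i\<close>.\<close>
      have "\<exists>t\<in>F. a $ i \<le> t + y \<and> t + y \<le> b $ i" if "a $ i - u \<le> y" "y \<le> b $ i - l" for y
        using that True ab by (intro bexI[of _ "max l (a $ i - y)"]) (auto simp: F)
      then have "{y. \<exists>t\<in>F. a $ i \<le> t + y \<and> t + y \<le> b $ i} = {a $ i - u .. b $ i - l}"
        by (force simp: F)
      then show ?thesis
        unfolding 1 2 using True ab 3
        by (simp add: F ennreal_plus[symmetric] del: ennreal_plus)
    next
      \<comment> \<open>Here \<open>F\<close> is empty, so both fibres are empty and the indicator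
        vanishes; no length is added.\<close>
      case False
      then show ?thesis
        unfolding 1 2 using 3 by (simp add: F)
    qed
  qed
  have "(\<lambda>w. emeasure lborel {y. w(i := y) \<in> ?W (insert i S) B}) \<in> borel_measurable (leb ?A)"
  proof -
    have "(\<lambda>(w, y). w(i := y)) \<in> measurable (leb ?A \<Otimes>\<^sub>M lborel) (leb (insert i ?A))"
      by (rule measurable_add_dim)
    then have "(\<lambda>(w, y). w(i := y)) -` ?W (insert i S) B \<inter> space (leb ?A \<Otimes>\<^sub>M lborel) \<in> sets (leb ?A \<Otimes>\<^sub>M lborel)"
      by measurable
    from sigma_finite_measure.measurable_emeasure_Pair[OF sigma_finite_lborel this]
    show ?thesis
      by (rule measurable_cong[THEN iffD1, rotated])
         (auto simp: space_pair_measure vimage_def)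
  qed
  note [measurable] = this
  let ?E = "\<lambda>w. emeasure lborel {y. w(i := y) \<in> ?W (insert i S) B}" and ?c = "ennreal (b $ i - a $ i)"
  have "emeasure (leb (insert i ?A)) (?W S (insert i B)) =
      (\<integral>\<^sup>+w. ?E w + ?c * indicator (?W S B) w \<partial>leb ?A)"
    unfolding ins[OF m1] by (rule nn_integral_cong) (rule fibre)
  also have "\<dots> = (\<integral>\<^sup>+w. ?E w \<partial>leb ?A) + (\<integral>\<^sup>+w. ?c * indicator (?W S B) w \<partial>leb ?A)"
    by (rule nn_integral_add) measurable
  also have "\<dots> = emeasure (leb (insert i ?A)) (?W (insert i S) B) + ?c * emeasure (leb ?A) (?W S B)"
    unfolding ins[OF m2] by (subst nn_integral_cmult_indicator) measurable
  finally show ?thesis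
    unfolding eq .
qed

lemma mixed_set_empty: "mixed_set X a b S {} = proj S ` X"
  by (auto simp: mixed_set_def image_iff fun_eq_iff PiE_def extensional_def) metis

text \<open>Induction on \<open>B\<close>: each relaxed coordinate is either turned into an
  equation, and then recorded in \<open>T\<close>, or dropped at the cost of a factor
  \<open>b $ i - a $ i\<close>. The first choice enlarges \<open>S\<close>, so \<open>S\<close> has
  to vary in the induction.\<close>

lemma emeasure_mixed_set:
  fixes X :: "(real^'n) set"
  assumes X: "compact X" "l1_convex X" and "S \<inter> B = {}" and ab: "\<And>i. a $ i \<le> b $ i"
  shows "emeasure (leb (S \<union> B)) (mixed_set X a b S B) =
    (\<Sum>T\<in>Pow B. emeasure (leb (S \<union> T)) (proj (S \<union> T) ` X) *
        ennreal (\<Prod>i\<in>B - T. b $ i - a $ i))"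
  using finite[of B] \<open>S \<inter> B = {}\<close>
proof (induction B arbitrary: S rule: finite_induct)
  case empty
  show ?case
    by (simp only: mixed_set_empty Un_empty_right Pow_empty sum.insert sum.empty finite.emptyI
        empty_iff Diff_empty prod.empty ennreal_1 mult_1_right add_0_right not_False_eq_True)
next
  case (insert i B)
  let ?P = "\<lambda>U. emeasure (leb U) (proj U ` X)"
  have inj: "inj_on (insert i) (Pow B)"
    using insert.hyps by (auto intro!: inj_onI)
  have "emeasure (leb (S \<union> insert i B)) (mixed_set X a b S (insert i B)) =
      emeasure (leb (insert i S \<union> B)) (mixed_set X a b (insert i S) B) +
      ennreal (b $ i - a $ i) * emeasure (leb (S \<union> B)) (mixed_set X a b S B)"
    using insert by (intro emeasure_mixed_set_insert X ab) auto
  also have "emeasure (leb (insert i S \<union> B)) (mixed_set X a b (insert i S) B) =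
      (\<Sum>T\<in>Pow B. ?P (insert i S \<union> T) * ennreal (\<Prod>i\<in>B - T. b $ i - a $ i))"
    using insert by (intro insert.IH) auto
  \<comment> \<open>The terms in which \<open>i\<close> became an equation are those of the subsets
    of \<open>insert i B\<close> containing \<open>i\<close>; the terms in which it was dropped will
    give the remaining subsets.\<close>
  also have "\<dots> = (\<Sum>T\<in>insert i ` Pow B. ?P (S \<union> T) * ennreal (\<Prod>i\<in>insert i B - T. b $ i - a $ i))"
    using insert.hyps
    by (subst sum.reindex[OF inj])
      (auto intro!: sum.cong arg_cong2[where f="(*)"] arg_cong[where f=ennreal] prod.cong
        arg_cong[where f="?P"])
  also have "emeasure (leb (S \<union> B)) (mixed_set X a b S B) =
      (\<Sum>T\<in>Pow B. ?P (S \<union> T) * ennreal (\<Prod>i\<in>B - T. b $ i - a $ i))"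
    using insert by (intro insert.IH) auto
  also have "ennreal (b $ i - a $ i) * \<dots> =
     (\<Sum>T\<in>Pow B. ?P (S \<union> T) * ennreal (\<Prod>i\<in>insert i B - T. b $ i - a $ i))"
    unfolding sum_distrib_left
  proof (rule sum.cong)
    fix T assume "T \<in> Pow B"
    then have "insert i B - T = insert i (B - T)" "i \<notin> B - T"
      using insert.hyps by auto
    then show "ennreal (b $ i - a $ i) * (?P (S \<union> T) * ennreal (\<Prod>i\<in>B - T. b $ i - a $ i)) =
        ?P (S \<union> T) * ennreal (\<Prod>i\<in>insert i B - T. b $ i - a $ i)"
      using ab by (simp add: ennreal_mult' mult_ac prod_nonneg)
  qed simp
  also have "(\<Sum>T\<in>insert i ` Pow B. ?P (S \<union> T) * ennreal (\<Prod>i\<in>insert i B - T. b $ i - a $ i)) + \<dots> =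
    (\<Sum>T\<in>Pow (insert i B). ?P (S \<union> T) * ennreal (\<Prod>i\<in>insert i B - T. b $ i - a $ i))"
    unfolding Pow_insert using insert.hyps by (subst add.commute, intro sum.union_disjoint[symmetric]) auto
  finally show ?case .
qed

section \<open>Product Lebesgue measure under reindexing, reflection and translation\<close>

lemma emeasure_lborel_affine_vimage:
  assumes "\<bar>c\<bar> = 1" and [measurable]: "E \<in> sets (lborel :: real measure)"
  shows "emeasure lborel {y. c * y + t \<in> E} = emeasure lborel E"
proof -
  have "c \<noteq> 0" using assms by auto
  then have "lborel = density (distr lborel borel (\<lambda>x. t + c * x)) (\<lambda>_. ennreal \<bar>c\<bar>)"
    by (rule lborel_real_affine)
  then have eq: "lborel = distr lborel borel (\<lambda>x. t + c * x)"
    using assms by (simp add: density_1)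
  show ?thesis
    using assms by (subst (2) eq, subst emeasure_distr) (auto simp: vimage_def add.commute)
qed

lemma measurable_leb_affine:
  assumes "\<And>i. i \<in> B \<Longrightarrow> \<sigma> i \<in> A"
  shows "(\<lambda>x. \<lambda>i\<in>B. c i * x (\<sigma> i) + t i) \<in> measurable (leb A) (leb B)"
proof (rule measurable_restrict)
  fix i assume "i \<in> B"
  then have "(\<lambda>x. x (\<sigma> i)) \<in> borel_measurable (leb A)"
    using measurable_component_singleton[OF assms, of i "\<lambda>_. lborel"] by simp
  then have "(\<lambda>x. c i * x (\<sigma> i) + t i) \<in> borel_measurable (leb A)"
    by (intro borel_measurable_add borel_measurable_times borel_measurable_const)
  then show "(\<lambda>x. c i * x (\<sigma> i) + t i) \<in> measurable (leb A) lborel"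
    by simp
qed

text \<open>Boxes determine the product measure, and the preimage of a box is again a box with its
  sides reindexed, reflected and translated. The lemma serves both the substitution in the
  translation integral and the invariance of projection volumes under signed permutations.\<close>

lemma distr_leb_affine:
  fixes A B :: "'n::finite set"
  assumes \<sigma>: "bij_betw \<sigma> B A" and c: "\<And>i. i \<in> B \<Longrightarrow> \<bar>c i\<bar> = 1"
  shows "distr (leb A) (leb B) (\<lambda>x. \<lambda>i\<in>B. c i * x (\<sigma> i) + t i) = leb B" (is "?P = _")
proof (rule leb.PiM_eqI)
  have \<sigma>A: "\<sigma> i \<in> A" if "i \<in> B" for i
    using that \<sigma> by (auto simp: bij_betw_def)
  have mf: "(\<lambda>x. \<lambda>i\<in>B. c i * x (\<sigma> i) + t i) \<in> measurable (leb A) (leb B)"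
    using \<sigma>A by (rule measurable_leb_affine)
  fix E assume E: "\<And>i. i \<in> B \<Longrightarrow> E i \<in> sets (lborel :: real measure)"
  define \<tau> where "\<tau> = inv_into B \<sigma>"
  have \<tau>: "\<tau> (\<sigma> i) = i" if "i \<in> B" for i
    using that \<sigma> by (auto simp: bij_betw_def \<tau>_def)
  have AB: "A = \<sigma> ` B"
    using \<sigma> by (auto simp: bij_betw_def)
  have "(\<lambda>x. \<lambda>i\<in>B. c i * x (\<sigma> i) + t i) -` Pi\<^sub>E B E \<inter> space (leb A) =
      (\<Pi>\<^sub>E j\<in>A. {y. c (\<tau> j) * y + t (\<tau> j) \<in> E (\<tau> j)})"
    by (auto simp: space_PiM PiE_def Pi_def AB \<tau>)
  then have "emeasure ?P (Pi\<^sub>E B E) = emeasure (leb A) (\<Pi>\<^sub>E j\<in>A. {y. c (\<tau> j) * y + t (\<tau> j) \<in> E (\<tau> j)})"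
    using E mf by (subst emeasure_distr) (auto intro!: sets_PiM_I_finite)
  also have "\<dots> = (\<Prod>j\<in>A. emeasure lborel {y. c (\<tau> j) * y + t (\<tau> j) \<in> E (\<tau> j)})"
  proof (rule leb.emeasure_PiM)
    fix j assume "j \<in> A"
    then have [measurable]: "E (\<tau> j) \<in> sets borel"
      using E[of "\<tau> j"] by (auto simp: AB \<tau>)
    show "{y. c (\<tau> j) * y + t (\<tau> j) \<in> E (\<tau> j)} \<in> sets lborel"
      by measurable
  qed simp
  also have "\<dots> = (\<Prod>i\<in>B. emeasure lborel {y. c i * y + t i \<in> E i})"
    by (subst prod.reindex_bij_betw[OF \<sigma>, symmetric]) (simp add: \<tau>)
  also have "\<dots> = (\<Prod>i\<in>B. emeasure lborel (E i))"
    using E c by (intro prod.cong emeasure_lborel_affine_vimage) auto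
  finally show "emeasure ?P (Pi\<^sub>E B E) = (\<Prod>i\<in>B. emeasure lborel (E i))" .
qed auto

lemma measurable_vec_lambda: "(\<lambda>w. \<chi> i. w i) \<in> borel_measurable (leb (UNIV :: 'n::finite set))"
  using measurable_extend_vec[of UNIV] by simp

text \<open>The translation parameter is a vector, but the substitution acts on functions coordinate
  by coordinate. Agreement on open boxes identifies the two versions of Lebesgue measure.\<close>

lemma lborel_vec_eq_distr:
  "(lborel :: (real^'n) measure) = distr (leb UNIV) borel (\<lambda>w. \<chi> i. w i)"
proof (rule lborel_eqI)
  note [measurable] = measurable_vec_lambda
  fix l u :: "real^'n" assume "\<And>b. b \<in> Basis \<Longrightarrow> l \<bullet> b \<le> u \<bullet> b"
  then have lu: "l $ i \<le> u $ i" for i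
    by (metis axis_in_Basis_iff cart_eq_inner_axis Basis_real_def singletonI)
  have "(\<lambda>w. \<chi> i. w i) -` box l u \<inter> space (leb UNIV) = (\<Pi>\<^sub>E i\<in>UNIV. {l $ i <..< u $ i})"
    by (auto simp: space_PiM mem_box_cart PiE_def Pi_def)
  then have "emeasure (distr (leb UNIV) borel (\<lambda>w. \<chi> i. w i)) (box l u) =
      emeasure (leb UNIV) (\<Pi>\<^sub>E i\<in>UNIV. {l $ i <..< u $ i})"
    by (subst emeasure_distr) auto
  also have "\<dots> = (\<Prod>i\<in>UNIV. ennreal (u $ i - l $ i))"
    using lu by (subst leb.emeasure_PiM) auto
  also have "\<dots> = ennreal (\<Prod>i\<in>UNIV. u $ i - l $ i)"
    using lu by (intro prod_ennreal) auto
  also have "(\<Prod>i\<in>UNIV. u $ i - l $ i) = (\<Prod>b\<in>Basis. (u - l) \<bullet> b)"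
  proof -
    have Basis: "(Basis :: (real^'n) set) = (\<lambda>i. axis i 1) ` UNIV"
      by (auto simp: Basis_vec_def)
    have "inj (\<lambda>i :: 'n. axis i (1::real))"
      by (auto simp: inj_def axis_eq_axis)
    then show ?thesis
      unfolding Basis by (subst prod.reindex) (simp_all add: inner_axis)
  qed
  finally show "emeasure (distr (leb UNIV) borel (\<lambda>w. \<chi> i. w i)) (box l u) =
      ennreal (\<Prod>b\<in>Basis. (u - l) \<bullet> b)" .
qed simp

section \<open>Projection volumes integrated over translations\<close>

lemma proj_cbox:
  assumes "\<And>i. a $ i \<le> b $ i"
  shows "proj J ` cbox a b = (\<Pi>\<^sub>E i\<in>J. {a $ i..b $ i})"
proof (intro equalityI subsetI)
  fix w assume w: "w \<in> (\<Pi>\<^sub>E i\<in>J. {a $ i..b $ i})"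
  \<comment> \<open>The missing coordinates must be filled by a point of the box;
    \<open>a $ i\<close> qualifies because every side is nonempty.\<close>
  then have "w = proj J (\<chi> i. if i \<in> J then w i else a $ i)"
    by (auto simp: fun_eq_iff PiE_def extensional_def)
  moreover have "(\<chi> i. if i \<in> J then w i else a $ i) \<in> cbox a b"
    using w assms by (auto simp: mem_box_cart)
  ultimately show "w \<in> proj J ` cbox a b"
    by blast
qed (auto simp: mem_box_cart)

lemma emeasure_leb_box:
  assumes "\<And>i. i \<in> J \<Longrightarrow> a $ i \<le> b $ i"
  shows "emeasure (leb J) (\<Pi>\<^sub>E i\<in>J. {a $ i..b $ i}) = ennreal (\<Prod>i\<in>J. b $ i - a $ i)"
  using assms by (subst leb.emeasure_PiM) (auto simp: prod_ennreal)

lemma proj_vol_cbox: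
  assumes "\<And>i. a $ i \<le> b $ i"
  shows "proj_vol J (cbox a b) = (\<Prod>i\<in>J. b $ i - a $ i)"
  unfolding proj_vol_def proj_cbox[OF assms] measure_def
  using emeasure_leb_box[of J a b] assms by (simp add: prod_nonneg)

text \<open>A bounded set projects into a box of finite volume, so passing to the real-valued
  \<open>proj_vol\<close> loses no information about the extended measure.\<close>

lemma emeasure_proj:
  assumes "bounded Y"
  shows "emeasure (leb U) (proj U ` Y) = ennreal (proj_vol U Y)"
proof -
  obtain a where a: "Y \<subseteq> cbox (- a) a"
    using bounded_subset_cbox_symmetric[OF assms] by blast
  have "emeasure (leb U) (proj U ` Y) \<noteq> \<infinity>"
  proof (cases "Y = {}")
    case False
    then obtain y where "y \<in> cbox (- a) a"
      using a by auto
    then have le: "(- a) $ i \<le> a $ i" for i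
      unfolding mem_box_cart by (meson order_trans)
    have "proj U ` Y \<subseteq> proj U ` cbox (- a) a"
      using a by (rule image_mono)
    then have "proj U ` Y \<subseteq> (\<Pi>\<^sub>E i\<in>U. {(- a) $ i..a $ i})"
      using proj_cbox[of "- a" a U] le by auto
    then have "emeasure (leb U) (proj U ` Y) \<le> emeasure (leb U) (\<Pi>\<^sub>E i\<in>U. {(- a) $ i..a $ i})"
      by (intro emeasure_mono sets_PiM_I_finite) auto
    also have "\<dots> < \<infinity>"
      using emeasure_leb_box[of U "- a" a] le by simp
    finally show ?thesis by simp
  qed simp
  then show ?thesis
    unfolding proj_vol_def by (intro emeasure_eq_ennreal_measure) simp
qed

text \<open>Tonelli for the set \<open>Q\<close> of pairs of a translation \<open>q\<close> and a
  point \<open>y\<close> of the projected intersection. Fixing \<open>q\<close> gives the integrand;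
  fixing \<open>y\<close> gives a set whose volume is the same for every \<open>y\<close> in the
  projected box and zero for every other \<open>y\<close>.\<close>

lemma nn_integral_emeasure_proj_translate:
  fixes X :: "(real^'n) set"
  assumes X: "compact X" and ab: "\<And>i. a $ i \<le> b $ i"
  shows "(\<lambda>q. emeasure (leb S) (proj S ` ((\<lambda>x. x + q) ` X \<inter> cbox a b))) \<in> borel_measurable borel"
    and "(\<integral>\<^sup>+q. emeasure (leb S) (proj S ` ((\<lambda>x. x + q) ` X \<inter> cbox a b)) \<partial>lborel) =
      ennreal (\<Prod>i\<in>S. b $ i - a $ i) * emeasure (leb UNIV) (mixed_set X a b S (- S))"
proof -
  let ?M = "lborel \<Otimes>\<^sub>M leb S"
  define Q where "Q = {(q, y). y \<in> space (leb S) \<and> (\<exists>x\<in>X. (\<forall>i\<in>S. x $ i + q $ i = y i) \<and>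
      (\<forall>i\<in>UNIV. a $ i \<le> x $ i + q $ i \<and> x $ i + q $ i \<le> b $ i))}"
  interpret S: sigma_finite_measure "leb S"
    by (rule leb.sigma_finite) simp
  interpret P: pair_sigma_finite "lborel :: (real^'n) measure" "leb S" ..
  have Q[measurable]: "Q \<in> sets ?M"
  proof -
    let ?T = "{p. (\<forall>i\<in>S. fst p $ i + fst (snd p) $ i = snd (snd p) $ i) \<and>
        (\<forall>i\<in>UNIV. a $ i \<le> fst p $ i + fst (snd p) $ i \<and> fst p $ i + fst (snd p) $ i \<le> b $ i)}"
    have "closed ?T"
      by (intro closed_Collect_conj closed_Collect_ball closed_Collect_eq closed_Collect_le
          continuous_intros)
    from closed_compact_projection[OF X this]
    have [measurable]: "{z. \<exists>x. x \<in> X \<and> (x, z) \<in> ?T} \<in> sets borel"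
      by (rule borel_closed)
    have "(\<lambda>p. (fst p, \<chi> i. if i \<in> S then snd p i else 0)) \<in> borel_measurable ?M"
      by (intro borel_measurable_Pair measurable_compose[OF measurable_snd measurable_extend_vec])
        measurable
    then have "(\<lambda>p. (fst p, \<chi> i. if i \<in> S then snd p i else 0)) -` {z. \<exists>x. x \<in> X \<and> (x, z) \<in> ?T} \<inter> space ?M \<in> sets ?M"
      by (rule measurable_sets) measurable
    then show ?thesis
      by (rule back_subst[where P="\<lambda>S. S \<in> _"]) (simp add: set_eq_iff Q_def space_pair_measure Bex_def, intro allI conj_commute)
  qed
  have slice: "proj S ` ((\<lambda>x. x + q) ` X \<inter> cbox a b) = Pair q -` Q" for q
  proof (intro equalityI subsetI)
    fix y assume "y \<in> Pair q -` Q"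
    then obtain x where x: "x \<in> X" "\<And>i. i \<in> S \<Longrightarrow> x $ i + q $ i = y i"
      "\<And>i. a $ i \<le> x $ i + q $ i" "\<And>i. x $ i + q $ i \<le> b $ i" and y: "y \<in> space (leb S)"
      by (auto simp: Q_def)
    have "y = proj S (x + q)"
      using x(2) y by (auto simp: fun_eq_iff space_PiM PiE_def extensional_def)
    moreover have "x + q \<in> cbox a b"
      using x by (auto simp: mem_box_cart)
    ultimately show "y \<in> proj S ` ((\<lambda>x. x + q) ` X \<inter> cbox a b)"
      using x(1) by blast
  qed (auto simp: Q_def mem_box_cart space_PiM)
  show "(\<lambda>q. emeasure (leb S) (proj S ` ((\<lambda>x. x + q) ` X \<inter> cbox a b))) \<in> borel_measurable borel"
    unfolding slice using S.measurable_emeasure_Pair[OF Q] by simp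
  have fibre: "emeasure lborel ((\<lambda>q. (q, y)) -` Q) =
      emeasure (leb UNIV) (mixed_set X a b S (- S)) * indicator (\<Pi>\<^sub>E i\<in>S. {a $ i..b $ i}) y"
    if y: "y \<in> space (leb S)" for y
  proof -
    \<comment> \<open>The substitution is \<open>q i = y i - w i\<close> on \<open>S\<close> and
      \<open>q i = w i\<close> elsewhere. It turns \<open>x i + q i = y i\<close> into
      \<open>x i = w i\<close>, and the box condition over \<open>S\<close> into a condition on
      \<open>y\<close> alone.\<close>
    let ?c = "\<lambda>i. if i \<in> S then - 1 else 1 :: real" and ?t = "\<lambda>i. if i \<in> S then y i else 0"
    let ?\<phi> = "\<lambda>w. \<lambda>i\<in>UNIV. ?c i * w (id i) + ?t i"
    have Qy: "(\<lambda>q. (q, y)) -` Q \<in> sets borel"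
      using sets_Pair2[OF Q] by simp
    have m\<phi>: "?\<phi> \<in> measurable (leb UNIV) (leb UNIV)"
      by (rule measurable_leb_affine) simp
    have "emeasure lborel ((\<lambda>q. (q, y)) -` Q) =
        emeasure (leb UNIV) ((\<lambda>w. \<chi> i. w i) -` (\<lambda>q. (q, y)) -` Q \<inter> space (leb UNIV))"
      unfolding lborel_vec_eq_distr using measurable_vec_lambda Qy by (rule emeasure_distr)
    also have "\<dots> = emeasure (distr (leb UNIV) (leb UNIV) ?\<phi>)
        ((\<lambda>w. \<chi> i. w i) -` (\<lambda>q. (q, y)) -` Q \<inter> space (leb UNIV))"
      by (subst distr_leb_affine) auto
    also have "\<dots> = emeasure (leb UNIV)
        (?\<phi> -` ((\<lambda>w. \<chi> i. w i) -` (\<lambda>q. (q, y)) -` Q \<inter> space (leb UNIV)) \<inter> space (leb UNIV))"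
      using m\<phi> measurable_sets[OF measurable_vec_lambda Qy] by (rule emeasure_distr)
    also have "?\<phi> -` ((\<lambda>w. \<chi> i. w i) -` (\<lambda>q. (q, y)) -` Q \<inter> space (leb UNIV)) \<inter> space (leb UNIV) =
        (if y \<in> (\<Pi>\<^sub>E i\<in>S. {a $ i..b $ i}) then mixed_set X a b S (- S) else {})" (is "?L = ?R")
    proof -
      have L: "w \<in> ?L \<longleftrightarrow> (\<exists>x\<in>X. (\<forall>i\<in>S. x $ i = w i \<and> a $ i \<le> y i \<and> y i \<le> b $ i) \<and>
          (\<forall>i\<in>-S. a $ i \<le> x $ i + w i \<and> x $ i + w i \<le> b $ i))" for w
      proof -
        have "w \<in> ?L \<longleftrightarrow> (\<exists>x\<in>X. (\<forall>i\<in>S. x $ i + ?\<phi> w i = y i) \<and>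
            (\<forall>i. a $ i \<le> x $ i + ?\<phi> w i \<and> x $ i + ?\<phi> w i \<le> b $ i))"
          using y by (simp add: Q_def space_PiM)
        moreover have "(\<forall>i\<in>S. x $ i + ?\<phi> w i = y i) \<and>
            (\<forall>i. a $ i \<le> x $ i + ?\<phi> w i \<and> x $ i + ?\<phi> w i \<le> b $ i) \<longleftrightarrow>
            (\<forall>i\<in>S. x $ i = w i \<and> a $ i \<le> y i \<and> y i \<le> b $ i) \<and>
            (\<forall>i\<in>-S. a $ i \<le> x $ i + w i \<and> x $ i + w i \<le> b $ i)" (is "?l \<longleftrightarrow> ?r") for x
        proof
          assume l: ?l
          have "x $ i = w i \<and> a $ i \<le> y i \<and> y i \<le> b $ i" if "i \<in> S" for i
            using conjunct1[OF l, THEN bspec, OF that] conjunct2[OF l, THEN spec, of i] that by simp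
          moreover have "a $ i \<le> x $ i + w i \<and> x $ i + w i \<le> b $ i" if "i \<in> - S" for i
            using conjunct2[OF l, THEN spec, of i] that by simp
          ultimately show ?r by blast
        next
          assume r: ?r
          have "a $ i \<le> x $ i + ?\<phi> w i \<and> x $ i + ?\<phi> w i \<le> b $ i" for i
            using conjunct1[OF r, THEN bspec, of i] conjunct2[OF r, THEN bspec, of i]
            by (cases "i \<in> S") simp_all
          moreover have "x $ i + ?\<phi> w i = y i" if "i \<in> S" for i
            using conjunct1[OF r, THEN bspec, OF that] that by simp
          ultimately show ?l by blast
        qed
        ultimately show ?thesis by (simp only:)
      qed
      have R: "w \<in> ?R \<longleftrightarrow> (\<exists>x\<in>X. (\<forall>i\<in>S. x $ i = w i \<and> a $ i \<le> y i \<and> y i \<le> b $ i) \<and>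
          (\<forall>i\<in>-S. a $ i \<le> x $ i + w i \<and> x $ i + w i \<le> b $ i))" for w
        using y by (auto simp: mixed_set_def space_PiM PiE_iff)
      show ?thesis
        by (rule set_eqI) (rule trans[OF L R[symmetric]])
    qed
    finally show ?thesis by simp
  qed
  have "(\<integral>\<^sup>+q. emeasure (leb S) (Pair q -` Q) \<partial>lborel) = emeasure ?M Q"
    by (rule S.emeasure_pair_measure_alt[OF Q, symmetric])
  also have "\<dots> = (\<integral>\<^sup>+y. emeasure lborel ((\<lambda>q. (q, y)) -` Q) \<partial>leb S)"
    by (rule P.emeasure_pair_measure_alt2[OF Q])
  also have "\<dots> = (\<integral>\<^sup>+y. emeasure (leb UNIV) (mixed_set X a b S (- S)) *
      indicator (\<Pi>\<^sub>E i\<in>S. {a $ i..b $ i}) y \<partial>leb S)"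
    by (intro nn_integral_cong fibre)
  also have "\<dots> = emeasure (leb UNIV) (mixed_set X a b S (- S)) *
      emeasure (leb S) (\<Pi>\<^sub>E i\<in>S. {a $ i..b $ i})"
    by (intro nn_integral_cmult_indicator sets_PiM_I_finite) auto
  also have "\<dots> = ennreal (\<Prod>i\<in>S. b $ i - a $ i) * emeasure (leb UNIV) (mixed_set X a b S (- S))"
    using emeasure_leb_box[of S a b] ab by (simp add: mult.commute)
  finally show "(\<integral>\<^sup>+q. emeasure (leb S) (proj S ` ((\<lambda>x. x + q) ` X \<inter> cbox a b)) \<partial>lborel) =
      ennreal (\<Prod>i\<in>S. b $ i - a $ i) * emeasure (leb UNIV) (mixed_set X a b S (- S))"
    unfolding slice .
qed

text \<open>The sides of the box over \<open>S\<close> come from Tonelli and those over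
  \<open>- S - T\<close> from the mixed set; together they are the sides over \<open>- T\<close>.
  The sizes of \<open>S \<union> T\<close> and \<open>- T\<close> add up to the dimension plus
  \<open>card S\<close>, the origin of the condition \<open>i + j = n + k\<close>.\<close>

lemma integral_proj_vol_translate:
  fixes X :: "(real^'n) set"
  assumes X: "compact X" "l1_convex X" and ab: "\<And>i. a $ i \<le> b $ i"
  shows "has_bochner_integral lborel (\<lambda>q. proj_vol S ((\<lambda>x. x + q) ` X \<inter> cbox a b))
    (\<Sum>T\<in>Pow (- S). proj_vol (S \<union> T) X * proj_vol (- T) (cbox a b))"
proof -
  let ?f = "\<lambda>q. emeasure (leb S) (proj S ` ((\<lambda>x. x + q) ` X \<inter> cbox a b))"
  have f: "?f q = ennreal (proj_vol S ((\<lambda>x. x + q) ` X \<inter> cbox a b))" for q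
    by (intro emeasure_proj) (simp add: bounded_Int)
  have nonneg: "0 \<le> proj_vol U Y" for U and Y :: "(real^'n) set"
    by (simp add: proj_vol_def)
  have "(\<integral>\<^sup>+q. ?f q \<partial>lborel) = ennreal (\<Prod>i\<in>S. b $ i - a $ i) *
      emeasure (leb (S \<union> - S)) (mixed_set X a b S (- S))"
    using nn_integral_emeasure_proj_translate(2)[OF X(1) ab] by simp
  also have "\<dots> = ennreal (\<Prod>i\<in>S. b $ i - a $ i) *
      (\<Sum>T\<in>Pow (- S). ennreal (proj_vol (S \<union> T) X) * ennreal (\<Prod>i\<in>- S - T. b $ i - a $ i))"
    using emeasure_mixed_set[OF X, of S "- S" a b] ab
    by (simp add: emeasure_proj compact_imp_bounded[OF X(1)])
  also have "\<dots> = (\<Sum>T\<in>Pow (- S). ennreal (proj_vol (S \<union> T) X * proj_vol (- T) (cbox a b)))"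
    unfolding sum_distrib_left
  proof (rule sum.cong)
    fix T assume T: "T \<in> Pow (- S)"
    have "(\<Prod>i\<in>- T. b $ i - a $ i) = (\<Prod>i\<in>S \<union> (- S - T). b $ i - a $ i)"
      using T by (intro prod.cong) auto
    also have "\<dots> = (\<Prod>i\<in>S. b $ i - a $ i) * (\<Prod>i\<in>- S - T. b $ i - a $ i)"
      by (intro prod.union_disjoint) auto
    finally show "ennreal (\<Prod>i\<in>S. b $ i - a $ i) *
        (ennreal (proj_vol (S \<union> T) X) * ennreal (\<Prod>i\<in>- S - T. b $ i - a $ i)) =
        ennreal (proj_vol (S \<union> T) X * proj_vol (- T) (cbox a b))"
      using ab by (simp add: proj_vol_cbox ennreal_mult nonneg prod_nonneg mult_ac)
  qed simp
  also have "\<dots> = ennreal (\<Sum>T\<in>Pow (- S). proj_vol (S \<union> T) X * proj_vol (- T) (cbox a b))"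
    by (intro sum_ennreal mult_nonneg_nonneg nonneg)
  finally have int: "(\<integral>\<^sup>+q. ?f q \<partial>lborel) =
      ennreal (\<Sum>T\<in>Pow (- S). proj_vol (S \<union> T) X * proj_vol (- T) (cbox a b))" .
  have "(\<lambda>q. enn2real (?f q)) \<in> borel_measurable borel"
    using nn_integral_emeasure_proj_translate(1)[OF X(1) ab, of S] by measurable
  then have "(\<lambda>q. proj_vol S ((\<lambda>x. x + q) ` X \<inter> cbox a b)) \<in> borel_measurable lborel"
    unfolding f by (simp add: nonneg)
  then show ?thesis
    using int unfolding f
    by (intro has_bochner_integral_nn_integral) (auto intro!: sum_nonneg simp: nonneg)
qed

section \<open>Averaging projection volumes over signed permutations\<close>

lemma sets_proj:
  fixes Y :: "(real^'n) set"
  assumes "compact Y"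
  shows "proj U ` Y \<in> sets (leb U)"
  \<comment> \<open>The bounds 0 are placeholders: with no relaxed coordinates there is no interval
    condition left.\<close>
  using sets_mixed_set[OF assms, of 0 0 U "{}"] by (simp only: mixed_set_empty Un_empty_right)

text \<open>Up to sign, coordinate \<open>i\<close> of the image is coordinate
  \<open>\<sigma> i\<close> of the original, so the two projections correspond under a
  measure-preserving reindexing with reflections.\<close>

lemma proj_vol_signed_permutation:
  fixes Y :: "(real^'n) set"
  assumes Y: "compact Y" and h: "compact ((\<lambda>x. \<chi> i. s i * x $ \<sigma> i) ` Y)"
    and \<sigma>: "\<sigma> permutes (UNIV :: 'n set)" and s: "\<And>i. \<bar>s i\<bar> = 1"
  shows "proj_vol U ((\<lambda>x. \<chi> i. s i * x $ \<sigma> i) ` Y) = proj_vol (\<sigma> ` U) Y"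
proof -
  let ?h = "\<lambda>x :: real^'n. \<chi> i. s i * x $ \<sigma> i"
  let ?\<phi> = "\<lambda>w. \<lambda>i\<in>U. s i * w (\<sigma> i) + 0"
  have \<phi>: "?\<phi> \<in> measurable (leb (\<sigma> ` U)) (leb U)"
    by (rule measurable_leb_affine) simp
  have "bij_betw \<sigma> U (\<sigma> ` U)"
    using permutes_inj_on[OF \<sigma>] by (auto simp: bij_betw_def)
  then have "emeasure (leb U) (proj U ` ?h ` Y) =
      emeasure (distr (leb (\<sigma> ` U)) (leb U) ?\<phi>) (proj U ` ?h ` Y)"
    using s by (subst distr_leb_affine) auto
  also have "\<dots> = emeasure (leb (\<sigma> ` U)) (?\<phi> -` (proj U ` ?h ` Y) \<inter> space (leb (\<sigma> ` U)))"
    using \<phi> sets_proj[OF h] by (rule emeasure_distr)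
  also have "?\<phi> -` (proj U ` ?h ` Y) \<inter> space (leb (\<sigma> ` U)) = proj (\<sigma> ` U) ` Y"
  proof (intro equalityI subsetI)
    fix w assume w: "w \<in> ?\<phi> -` (proj U ` ?h ` Y) \<inter> space (leb (\<sigma> ` U))"
    then have "?\<phi> w \<in> (\<lambda>y. proj U (?h y)) ` Y"
      by (simp only: image_image Int_iff vimage_eq)
    then obtain y where y: "?\<phi> w = proj U (?h y)" "y \<in> Y"
      by (rule imageE)
    have "w (\<sigma> i) = y $ \<sigma> i" if "i \<in> U" for i
      using fun_cong[OF y(1), of i] that s[of i] by auto
    then have "w = proj (\<sigma> ` U) y"
      using w by (auto simp: fun_eq_iff space_PiM PiE_def extensional_def)
    then show "w \<in> proj (\<sigma> ` U) ` Y"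
      using y by blast
  next
    fix w assume "w \<in> proj (\<sigma> ` U) ` Y"
    then obtain y where y: "y \<in> Y" "w = proj (\<sigma> ` U) y"
      by auto
    then have "?\<phi> w = proj U (?h y)"
      by (auto simp: fun_eq_iff)
    then have "?\<phi> w \<in> proj U ` ?h ` Y"
      using imageI[OF imageI[OF y(1), of ?h], of "proj U"] by (simp only:)
    moreover have "w \<in> space (leb (\<sigma> ` U))"
      using y by (auto simp: space_PiM)
    ultimately show "w \<in> ?\<phi> -` (proj U ` ?h ` Y) \<inter> space (leb (\<sigma> ` U))"
      by (simp only: Int_iff vimage_eq)
  qed
  finally show ?thesis
    unfolding proj_vol_def measure_def by (rule arg_cong)
qed

lemma HnE:
  fixes h :: "real^'n \<Rightarrow> real^'n"
  assumes "h \<in> Hn"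
  obtains \<sigma> s where "\<sigma> permutes UNIV" "\<And>i. \<bar>s i\<bar> = 1" "h = (\<lambda>x. \<chi> i. s i * x $ \<sigma> i)"
  using assms unfolding Hn_def by (smt (verit) mem_Collect_eq)

lemma finite_Hn: "finite (Hn :: (real^'n \<Rightarrow> real^'n) set)"
proof (rule finite_subset)
  show "Hn \<subseteq> (\<lambda>(\<sigma>, s) x. \<chi> i. s i * x $ \<sigma> i) `
      ({\<sigma>. \<sigma> permutes (UNIV :: 'n set)} \<times> (\<Pi>\<^sub>E i\<in>UNIV. {1, -1 :: real}))"
    unfolding Hn_def by (auto simp: image_iff PiE_def)
qed (intro finite_imageI finite_cartesian_product finite_permutations finite_PiE, auto)

lemma Hn_nonempty: "(Hn :: (real^'n \<Rightarrow> real^'n) set) \<noteq> {}"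
proof -
  have "(\<lambda>x. \<chi> i. 1 * x $ id i) \<in> (Hn :: (real^'n \<Rightarrow> real^'n) set)"
    unfolding Hn_def mem_Collect_eq
    by (intro exI[of _ id] exI[of _ "\<lambda>_. 1"]) (simp add: permutes_id)
  then show ?thesis by blast
qed

lemma Hn_permute:
  fixes h :: "real^'n \<Rightarrow> real^'n"
  assumes "h \<in> Hn" "\<tau> permutes UNIV"
  shows "(\<lambda>x. \<chi> i. h x $ \<tau> i) \<in> Hn"
proof -
  obtain \<sigma> s where "\<sigma> permutes UNIV" "\<forall>i. s i = 1 \<or> s i = -1" "h = (\<lambda>x. \<chi> i. s i * x $ \<sigma> i)"
    using assms(1) unfolding Hn_def by blast
  then have "\<sigma> \<circ> \<tau> permutes UNIV" "\<forall>i. (s \<circ> \<tau>) i = 1 \<or> (s \<circ> \<tau>) i = -1"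
      "(\<lambda>x. \<chi> i. h x $ \<tau> i) = (\<lambda>x. \<chi> i. (s \<circ> \<tau>) i * x $ (\<sigma> \<circ> \<tau>) i)"
    using assms(2) by (auto intro: permutes_compose)
  then show ?thesis
    unfolding Hn_def mem_Collect_eq by (intro exI[of _ "\<sigma> \<circ> \<tau>"] exI[of _ "s \<circ> \<tau>"] conjI)
qed

lemma compact_Hn:
  fixes h :: "real^'n \<Rightarrow> real^'n"
  assumes "h \<in> Hn" "compact X"
  shows "compact (h ` X)"
proof -
  obtain \<sigma> s where "h = (\<lambda>x. \<chi> i. s i * x $ \<sigma> i)"
    using assms(1) by (rule HnE)
  then have "continuous_on X h"
    by (auto intro!: continuous_on_vec_lambda continuous_intros)
  then show ?thesis
    using assms(2) by (rule compact_continuous_image)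
qed

lemma l1dist_Hn:
  fixes h :: "real^'n \<Rightarrow> real^'n"
  assumes "h \<in> Hn"
  shows "l1dist (h x) (h y) = l1dist x y"
proof -
  obtain \<sigma> s where \<sigma>: "\<sigma> permutes UNIV" and s: "\<And>i. \<bar>s i\<bar> = 1"
    and h: "h = (\<lambda>x. \<chi> i. s i * x $ \<sigma> i)"
    using assms by (rule HnE) blast
  have "l1dist (h x) (h y) = (\<Sum>i\<in>UNIV. \<bar>x $ \<sigma> i - y $ \<sigma> i\<bar>)"
    unfolding l1dist_def h by (simp add: right_diff_distrib[symmetric] abs_mult s)
  also have "\<dots> = l1dist x y"
    unfolding l1dist_def using sum.permute[OF \<sigma>, of "\<lambda>i. \<bar>x $ i - y $ i\<bar>"] by (simp add: o_def)
  finally show ?thesis .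
qed

lemma l1_convex_Hn:
  fixes h :: "real^'n \<Rightarrow> real^'n"
  assumes h: "h \<in> Hn" and X: "l1_convex X"
  shows "l1_convex (h ` X)"
  unfolding l1_convex_def
proof (intro ballI)
  fix y y' assume "y \<in> h ` X" "y' \<in> h ` X"
  then obtain x x' where x: "x \<in> X" "x' \<in> X" "y = h x" "y' = h x'"
    by auto
  then obtain \<gamma> where "\<gamma> ` {0..l1dist x x'} \<subseteq> X" "\<gamma> 0 = x" "\<gamma> (l1dist x x') = x'"
    "\<forall>s\<in>{0..l1dist x x'}. \<forall>t\<in>{0..l1dist x x'}. l1dist (\<gamma> s) (\<gamma> t) = \<bar>s - t\<bar>"
    using X unfolding l1_convex_def by metis
  then show "\<exists>\<gamma>. \<gamma> ` {0..l1dist y y'} \<subseteq> h ` X \<and> \<gamma> 0 = y \<and> \<gamma> (l1dist y y') = y' \<and>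
      (\<forall>s\<in>{0..l1dist y y'}. \<forall>t\<in>{0..l1dist y y'}. l1dist (\<gamma> s) (\<gamma> t) = \<bar>s - t\<bar>)"
    by (intro exI[of _ "h \<circ> \<gamma>"]) (auto simp: x l1dist_Hn[OF h])
qed

text \<open>A signed permutation only rearranges the summands, since \<open>\<sigma>\<close>
  permutes the coordinate sets of each size.\<close>

lemma V_Hn:
  fixes h :: "real^'n \<Rightarrow> real^'n"
  assumes h: "h \<in> Hn" and X: "compact X"
  shows "V i (h ` X) = V i X"
proof -
  obtain \<sigma> s where \<sigma>: "\<sigma> permutes (UNIV :: 'n set)" and s: "\<And>i. \<bar>s i\<bar> = 1"
    and h_eq: "h = (\<lambda>x. \<chi> i. s i * x $ \<sigma> i)"
    using h by (rule HnE) blast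
  have inj: "inj \<sigma>"
    using \<sigma> by (rule permutes_inj)
  have "bij_betw (image \<sigma>) {S. card S = i} {S. card S = i}"
    by (rule bij_betw_byWitness[where f' = "image (inv \<sigma>)"])
       (use permutes_inverses[OF \<sigma>] in \<open>auto simp: image_image card_image inj_on_subset[OF inj]
         inj_on_subset[OF permutes_inj[OF permutes_inv[OF \<sigma>]]]\<close>)
  then have "(\<Sum>S | card S = i. proj_vol (\<sigma> ` S) X) = V i X"
    unfolding V_def by (rule sum.reindex_bij_betw)
  moreover have "proj_vol S (h ` X) = proj_vol (\<sigma> ` S) X" for S
    unfolding h_eq using X compact_Hn[OF h X, unfolded h_eq] \<sigma> s
    by (rule proj_vol_signed_permutation)
  ultimately show ?thesis
    by (simp add: V_def)
qed

text \<open>Following each \<open>h\<close> by the permutation \<open>\<tau>\<close> of coordinates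
  is a bijection of \<open>Hn\<close>, and it replaces the projection to \<open>U\<close> by the one
  to the image of \<open>U\<close> under \<open>\<tau>\<close>.\<close>

lemma sum_Hn_proj_vol_permute:
  fixes X :: "(real^'n) set"
  assumes X: "compact X" and \<tau>: "\<tau> permutes UNIV"
  shows "(\<Sum>h\<in>Hn. proj_vol (\<tau> ` U) (h ` X)) = (\<Sum>h\<in>Hn. proj_vol U (h ` X))"
proof -
  let ?p = "\<lambda>\<tau> (h :: real^'n \<Rightarrow> real^'n) x. \<chi> i. h x $ \<tau> i"
  have "bij_betw (?p \<tau>) Hn Hn"
    by (rule bij_betw_byWitness[where f' = "?p (inv \<tau>)"])
       (use permutes_inverses[OF \<tau>] in \<open>auto intro!: Hn_permute \<tau> permutes_inv\<close>)
  then have "(\<Sum>h\<in>Hn. proj_vol U (?p \<tau> h ` X)) = (\<Sum>h\<in>Hn. proj_vol U (h ` X))"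
    by (rule sum.reindex_bij_betw)
  moreover have "proj_vol U (?p \<tau> h ` X) = proj_vol (\<tau> ` U) (h ` X)" if h: "h \<in> Hn" for h
  proof -
    have "?p \<tau> h ` X = (\<lambda>x. \<chi> i. 1 * x $ \<tau> i) ` h ` X"
      by (simp add: image_image)
    moreover have "proj_vol U ((\<lambda>x. \<chi> i. 1 * x $ \<tau> i) ` h ` X) = proj_vol (\<tau> ` U) (h ` X)"
      using compact_Hn[OF h X] _ \<tau>
    proof (rule proj_vol_signed_permutation)
      show "compact ((\<lambda>x. \<chi> i. 1 * x $ \<tau> i) ` h ` X)"
        using compact_Hn[OF Hn_permute[OF h \<tau>] X] by (simp add: image_image)
    qed simp
    ultimately show ?thesis by simp
  qed
  ultimately show ?thesis by simp
qed

text \<open>The complements have equal size too, so a bijection between the sets and one between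
  their complements glue to a permutation.\<close>

lemma ex_permutes_image:
  fixes U U' :: "'n::finite set"
  assumes "card U = card U'"
  obtains \<tau> where "\<tau> permutes UNIV" "\<tau> ` U = U'"
proof -
  obtain f where f: "bij_betw f U U'"
    using finite_same_card_bij[OF _ _ assms] by auto
  have "card (- U) = card (- U')"
    using assms by (simp add: Compl_eq_Diff_UNIV card_Diff_subset)
  then obtain g where g: "bij_betw g (- U) (- U')"
    using finite_same_card_bij by (metis finite)
  let ?\<tau> = "\<lambda>x. if x \<in> U then f x else g x"
  have \<tau>: "bij_betw ?\<tau> U U'" "bij_betw ?\<tau> (- U) (- U')"
    using f g bij_betw_cong[of U f ?\<tau> U'] bij_betw_cong[of "- U" g ?\<tau> "- U'"] by simp_all
  from bij_betw_combine[OF this] have "bij ?\<tau>"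
    by simp
  then have "?\<tau> permutes UNIV"
    by (intro bij_imp_permutes) auto
  moreover have "?\<tau> ` U = U'"
    using \<tau>(1) by (simp add: bij_betw_def)
  ultimately show thesis by (rule that)
qed

lemma sum_Hn_proj_vol:
  fixes X :: "(real^'n) set"
  assumes X: "compact X"
  shows "(\<Sum>h\<in>Hn. proj_vol U (h ` X)) =
    real (card (Hn :: (real^'n \<Rightarrow> real^'n) set)) * V (card U) X / real (CARD('n) choose card U)"
proof -
  let ?G = "\<lambda>U. \<Sum>h\<in>Hn. proj_vol U (h ` X)"
  have G: "?G U' = ?G U" if eq: "card U' = card U" for U'
  proof -
    obtain \<tau> where "\<tau> permutes UNIV" "\<tau> ` U = U'"
      using ex_permutes_image[OF eq[symmetric]] .
    then show ?thesis
      using sum_Hn_proj_vol_permute[OF X, of \<tau> U] by simp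
  qed
  let ?A = "\<Sum>U' | card U' = card U. ?G U'"
  have "?A = (\<Sum>U'\<in>{U' :: 'n set. card U' = card U}. ?G U)"
  proof (rule sum.cong)
    fix U' :: "'n set" assume "U' \<in> {U'. card U' = card U}"
    then show "?G U' = ?G U"
      by (intro G) (rule CollectD)
  qed simp
  also have "\<dots> = real (CARD('n) choose card U) * ?G U"
    using n_subsets[of "UNIV :: 'n set" "card U"] by simp
  finally have 1: "?A = real (CARD('n) choose card U) * ?G U" .
  have "?A = (\<Sum>h\<in>Hn. V (card U) (h ` X))"
    unfolding V_def by (rule sum.swap)
  also have "\<dots> = (\<Sum>h\<in>(Hn :: (real^'n \<Rightarrow> real^'n) set). V (card U) X)"
    using X by (intro sum.cong V_Hn) auto
  finally have 2: "?A = real (card (Hn :: (real^'n \<Rightarrow> real^'n) set)) * V (card U) X"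
    by simp
  have "CARD('n) choose card U \<noteq> 0"
    by (simp add: card_mono not_less)
  then show ?thesis
    using 1 2 by (metis nonzero_mult_div_cancel_left of_nat_eq_0_iff)
qed

section \<open>Integration over all isometries and collection of terms by cardinality\<close>

theorem theorem8p4:
  fixes X :: "(real^'n) set" and a b :: "real^'n" and k :: nat
  assumes "k \<le> CARD('n)"
    and "compact X" and "l1_convex X"
  shows "isom_integral (\<lambda>g. V k (g ` X \<inter> cbox a b)) =
    (\<Sum>(i, j)\<in>{(i, j). i \<le> CARD('n) \<and> j \<le> CARD('n) \<and> i + j = CARD('n) + k}.
       inverse (real (CARD('n) choose i)) * real (j choose k) * V i X * V j (cbox a b))"
proof (cases "\<forall>i. a $ i \<le> b $ i")
  \<comment> \<open>The box is empty, so both sides vanish. This case is separate because products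
    of \<open>b $ i - a $ i\<close> compute volumes only for nonempty sides.\<close>
  case False
  then have "cbox a b = {}"
    by (auto simp: interval_eq_empty_cart not_le)
  moreover have "V j ({} :: (real^'n) set) = 0" for j
    by (simp add: V_def proj_vol_def)
  ultimately show ?thesis
    by (simp add: isom_integral_def case_prod_unfold)
next
  case True
  let ?n = "CARD('n)" and ?c = "\<lambda>J. proj_vol J (cbox a b)"
  let ?N = "real (card (Hn :: (real^'n \<Rightarrow> real^'n) set))"
  define v where "v m = V m X / real (?n choose m)" for m
  let ?F = "\<lambda>J. real (card J choose k) * v (?n + k - card J) * ?c J"
  have N: "?N > 0"
    using finite_Hn Hn_nonempty by (simp add: card_gt_0_iff)
  have "(LINT q|lborel. V k ((\<lambda>x. h x + q) ` X \<inter> cbox a b)) =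
      (\<Sum>S | card S = k. \<Sum>T\<in>Pow (- S). proj_vol (S \<union> T) (h ` X) * ?c (- T))" if h: "h \<in> Hn" for h
  proof -
    have "(\<lambda>x. h x + q) ` X = (\<lambda>x. x + q) ` h ` X" for q
      by (simp add: image_image)
    then have "has_bochner_integral lborel (\<lambda>q. V k ((\<lambda>x. h x + q) ` X \<inter> cbox a b))
        (\<Sum>S | card S = k. \<Sum>T\<in>Pow (- S). proj_vol (S \<union> T) (h ` X) * ?c (- T))"
      unfolding V_def using assms True h
      by (auto intro!: has_bochner_integral_sum integral_proj_vol_translate compact_Hn l1_convex_Hn)
    then show ?thesis
      by (rule has_bochner_integral_integral_eq)
  qed
  then have "isom_integral (\<lambda>g. V k (g ` X \<inter> cbox a b)) =
      (\<Sum>h\<in>Hn. \<Sum>S | card S = k. \<Sum>T\<in>Pow (- S). proj_vol (S \<union> T) (h ` X) * ?c (- T)) / ?N"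
    unfolding isom_integral_def by simp
  also have "\<dots> = (\<Sum>S | card S = k. \<Sum>h\<in>Hn. \<Sum>T\<in>Pow (- S). proj_vol (S \<union> T) (h ` X) * ?c (- T)) / ?N"
    by (subst sum.swap) simp
  also have "\<dots> = (\<Sum>S | card S = k. \<Sum>T\<in>Pow (- S). (\<Sum>h\<in>Hn. proj_vol (S \<union> T) (h ` X)) * ?c (- T)) / ?N"
  proof -
    have "(\<Sum>h\<in>Hn. \<Sum>T\<in>Pow (- S). proj_vol (S \<union> T) (h ` X) * ?c (- T)) =
        (\<Sum>T\<in>Pow (- S). (\<Sum>h\<in>Hn. proj_vol (S \<union> T) (h ` X)) * ?c (- T))" for S
      unfolding sum_distrib_right by (rule sum.swap)
    then show ?thesis by simp
  qed
  also have "\<dots> = (\<Sum>S | card S = k. \<Sum>T\<in>Pow (- S). v (card (S \<union> T)) * ?c (- T))"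
    unfolding sum_divide_distrib sum_Hn_proj_vol[OF assms(2)] v_def
    using N by (intro sum.cong) auto
  \<comment> \<open>Reindexing by \<open>J = - T\<close>, the set of sides of the box that survive;
    \<open>S\<close> and \<open>T\<close> are disjoint exactly when \<open>S\<close> lies in
    \<open>J\<close>.\<close>
  also have "\<dots> = (\<Sum>S | card S = k. \<Sum>J | S \<subseteq> J. v (?n + k - card J) * ?c J)"
  proof (rule sum.cong)
    fix S :: "'n set" assume S: "S \<in> {S. card S = k}"
    have "card (S \<union> - J) = ?n + k - card J" if "S \<subseteq> J" for J
    proof -
      have "card (S \<union> - J) = card S + card (- J)"
        using that by (intro card_Un_disjoint) auto
      then show ?thesis
        using S card_mono[of UNIV J] by (simp add: Compl_eq_Diff_UNIV card_Diff_subset)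
    qed
    moreover have "bij_betw uminus {J. S \<subseteq> J} (Pow (- S))"
      by (rule bij_betw_byWitness[where f' = uminus]) auto
    ultimately show "(\<Sum>T\<in>Pow (- S). v (card (S \<union> T)) * ?c (- T)) =
        (\<Sum>J | S \<subseteq> J. v (?n + k - card J) * ?c J)"
      by (subst sum.reindex_bij_betw[symmetric, of uminus "{J. S \<subseteq> J}"]) auto
  qed simp
  also have "\<dots> = (\<Sum>J\<in>UNIV. \<Sum>S | card S = k \<and> S \<subseteq> J. v (?n + k - card J) * ?c J)"
    using sum.swap_restrict[of "{S. card S = k}" UNIV "\<lambda>S J. v (?n + k - card J) * ?c J" "(\<subseteq>)"]
    by simp
  \<comment> \<open>The summand does not depend on \<open>S\<close>, and \<open>J\<close> has
    \<open>card J choose k\<close> subsets of size \<open>k\<close>: this is the source of the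
    binomial factor.\<close>
  also have "\<dots> = (\<Sum>J\<in>UNIV. ?F J)"
    using n_subsets[of "_ :: 'n set" k] by (simp add: conj_commute mult.assoc)
  also have "\<dots> = (\<Sum>j\<le>?n. \<Sum>J | card J = j. ?F J)"
    using sum.group[of "UNIV :: 'n set set" "{..?n}" card ?F] card_mono[of "UNIV :: 'n set"]
    by (simp add: image_subset_iff)
  also have "\<dots> = (\<Sum>j\<le>?n. real (j choose k) * v (?n + k - j) * V j (cbox a b))"
    unfolding V_def[of _ "cbox a b"] sum_distrib_left by (intro sum.cong) auto
  \<comment> \<open>Terms with \<open>j < k\<close> have binomial coefficient zero. Dropping them
    ensures that \<open>?n + k - j\<close> is at most \<open>?n\<close>, as the index set of the
    theorem demands.\<close>
  also have "\<dots> = (\<Sum>j\<in>{k..?n}. real (j choose k) * v (?n + k - j) * V j (cbox a b))"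
    by (intro sum.mono_neutral_right) (auto simp: not_le)
  also have "\<dots> = (\<Sum>(i, j)\<in>{(i, j). i \<le> ?n \<and> j \<le> ?n \<and> i + j = ?n + k}.
       inverse (real (?n choose i)) * real (j choose k) * V i X * V j (cbox a b))"
    by (rule sum.reindex_bij_witness[where i = snd and j = "\<lambda>j. (?n + k - j, j)"])
       (auto simp: v_def field_simps)
  finally show ?thesis .
qed

end
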